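(* Let $a$ and $d$ be positive integers with $a\ge 2$ and $\gcd(a,d)=1$, let $K$ and $k$ be positive integers with $(k-1)/2<K\le (2k-2)/3$, let $r=a+K-\lfloor (a+K)/k\rfloor k$, and assume $\lfloor (a+K)/k\rfloor\ge 2$. Write $N=n\bigl(a,a+(K+1)d,a+(K+2)d,\dots,a+k d\bigr)$. If $0\le r\le k-K-1$, then $$ N=\frac{a^2+2(3 K-k)a+K(5 K-7 k)+k(2 k-1)-r(r+4 K-3 k)}{2 k}+\left(\frac{a+1}{2}+3 K-k\right)d. $$ If $k-K\le r\le K$, then $$ N=\frac{a^2+2(3 K-k)a+(K-r)(5 K-5 k+r)+k}{2 k}+\left(\frac{a+1}{2}+3 K-k\right)d. $$ If $K+1\le r<k$, then $$ N=\frac{a^2+2(3 K-k)a+K(5 K-3 k)-k-r(r+4 K-3 k)}{2 k}+\left(\frac{a+1}{2}+3 K-k\right)d. $$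
   Context: For positive integers $a_1,\dots,a_m$ with $\gcd(a_1,\dots,a_m)=1$, the Sylvester number $n(a_1,\dots,a_m)$ is the number of positive integers that cannot be written as $x_1a_1+\cdots+x_ma_m$ with nonnegative integers $x_i$. $\lfloor x\rfloor$ denotes the floor. *)

theory Defs
  imports Complex_Main
begin

definition representable :: "nat list \<Rightarrow> nat \<Rightarrow> bool" where
  "representable as n \<longleftrightarrow> (\<exists>x :: nat \<Rightarrow> nat. n = (\<Sum>i<length as. x i * as ! i))"

(* The Sylvester number is meant for positive generators with greatest common divisor 1; the set
   of gaps is then finite, so that card is a genuine count. *)
definition sylvester_number :: "nat list \<Rightarrow> nat" where
  "sylvester_number as = card {n. n > 0 \<and> \<not> representable as n}"

end

theory Submission
  imports Defs "HOL-Number_Theory.Cong"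
begin

text \<open>The number of gaps is computed from the Apery set. An element of the semigroup has the form
  \<open>c a + t d\<close> where \<open>t\<close> is a sum of at most \<open>c\<close> members of \<open>{K+1..k}\<close>. The sums of exactly \<open>s\<close> members
  fill the interval \<open>[s(K+1), s k]\<close>, and the bounds on \<open>K\<close> leave exactly two gaps between these
  intervals, \<open>[1, K]\<close> and \<open>[k+1, 2K+1]\<close>. So the least element congruent to \<open>t d\<close> modulo \<open>a\<close>, for
  \<open>t < a\<close>, is \<open>a \<lceil>t/k\<rceil> + t d\<close>, except that \<open>t\<close> must be replaced by \<open>t + a\<close> on the two gaps.\<close>

section \<open>Counting gaps by the Apery set\<close>

text \<open>These numbers are \<open>w mod a + a * i\<close> with \<open>i < w div a\<close>. When
  \<open>w\<close> is the least semigroup element of its residue class, they are the gaps in that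
  class.\<close>

lemma card_residue_class_below:
  fixes a w :: nat
  assumes "a > 0"
  shows "card {n. n < w \<and> [n = w] (mod a)} = w div a"
proof -
  have "{n. n < w \<and> [n = w] (mod a)} = (\<lambda>i. w mod a + a * i) ` {..<w div a}"
  proof (intro set_eqI iffI)
    fix n assume "n \<in> {n. n < w \<and> [n = w] (mod a)}"
    then have n: "n < w" "n mod a = w mod a" by (auto simp: cong_def)
    have e: "n = w mod a + a * (n div a)" using n(2) by (metis mod_mult_div_eq)
    have "w = w mod a + a * (w div a)" by simp
    with e n(1) have "a * (n div a) < a * (w div a)" by linarith
    then have "n div a < w div a" by simp
    with e show "n \<in> (\<lambda>i. w mod a + a * i) ` {..<w div a}" by blast
  next
    fix n assume "n \<in> (\<lambda>i. w mod a + a * i) ` {..<w div a}"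
    then obtain i where i: "n = w mod a + a * i" "i < w div a" by blast
    have "w = w mod a + a * (w div a)" by simp
    moreover have "a * i < a * (w div a)" using i assms by simp
    ultimately have "n < w" using i by linarith
    then show "n \<in> {n. n < w \<and> [n = w] (mod a)}" using i by (simp add: cong_def)
  qed
  moreover have "inj_on (\<lambda>i. w mod a + a * i) {..<w div a}"
    using assms by (auto intro: inj_onI)
  ultimately show ?thesis by (simp add: card_image)
qed

text \<open>Coprimality makes \<open>d\<close> cancellable modulo \<open>a\<close>, and an injective
  self-map of a finite set is onto. Residue classes can hence be indexed by the multiples
  \<open>t * d\<close>.\<close>

lemma bij_betw_mult_mod:
  fixes a d :: nat
  assumes "a > 0" "coprime a d"
  shows "bij_betw (\<lambda>t. t * d mod a) {..<a} {..<a}"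
proof -
  have "inj_on (\<lambda>t. t * d mod a) {..<a}"
  proof (rule inj_onI)
    fix x y assume xy: "x \<in> {..<a}" "y \<in> {..<a}" "x * d mod a = y * d mod a"
    then have "[x = y] (mod a)"
      using assms(2) by (metis cong_def cong_mult_rcancel_nat coprime_commute)
    then show "x = y" using xy by (simp add: cong_def)
  qed
  moreover have "(\<lambda>t. t * d mod a) ` {..<a} = {..<a}"
    by (rule endo_inj_surj) (use assms calculation in auto)
  ultimately show ?thesis by (simp add: bij_betw_def)
qed

text \<open>The gaps are split by residue class. By \<open>rep\<close>, \<open>w t\<close> is the
  least element of \<open>P\<close> in the class of \<open>t * d\<close> and all later members of
  the class satisfy \<open>P\<close>, so \<open>w\<close> lists the Apery set and each class
  contributes \<open>w t div a\<close> gaps.\<close>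

lemma card_gaps_apery:
  fixes a d :: nat and w :: "nat \<Rightarrow> nat"
  assumes a: "a > 0" and cop: "coprime a d"
    and w: "\<And>t. t < a \<Longrightarrow> [w t = t * d] (mod a)"
    and rep: "\<And>n t. t < a \<Longrightarrow> [n = t * d] (mod a) \<Longrightarrow> P n \<longleftrightarrow> w t \<le> n"
  shows "card {n. \<not> P n} = (\<Sum>t<a. w t div a)"
proof -
  let ?A = "\<lambda>t. {n. n < w t \<and> [n = w t] (mod a)}"
  have bij: "bij_betw (\<lambda>t. t * d mod a) {..<a} {..<a}"
    by (rule bij_betw_mult_mod[OF a cop])
  have "{n. \<not> P n} = (\<Union>t\<in>{..<a}. ?A t)"
  proof (intro set_eqI iffI)
    fix n assume n: "n \<in> {n. \<not> P n}"
    have "n mod a \<in> (\<lambda>t. t * d mod a) ` {..<a}"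
      using bij a by (simp add: bij_betw_def)
    then obtain t where t: "t < a" "[n = t * d] (mod a)" by (auto simp: cong_def)
    then have "n < w t" using rep[OF t] n by simp
    moreover have "[n = w t] (mod a)" using t w[OF t(1)] by (simp add: cong_def)
    ultimately show "n \<in> (\<Union>t\<in>{..<a}. ?A t)" using t(1) by blast
  next
    fix n assume "n \<in> (\<Union>t\<in>{..<a}. ?A t)"
    then obtain t where t: "t < a" "n < w t" "[n = w t] (mod a)" by blast
    then have "[n = t * d] (mod a)" using w[OF t(1)] by (simp add: cong_def)
    then show "n \<in> {n. \<not> P n}" using rep[OF t(1)] t(2) by auto
  qed
  moreover have "card (\<Union>t\<in>{..<a}. ?A t) = (\<Sum>t<a. card (?A t))"
  proof (rule card_UN_disjoint)
    show "\<forall>i\<in>{..<a}. \<forall>j\<in>{..<a}. i \<noteq> j \<longrightarrow> ?A i \<inter> ?A j = {}"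
    proof (intro ballI impI)
      fix i j assume ij: "i \<in> {..<a}" "j \<in> {..<a}" "i \<noteq> j"
      then have "i * d mod a \<noteq> j * d mod a"
        using bij_betw_imp_inj_on[OF bij] inj_on_contraD by fastforce
      then have "w i mod a \<noteq> w j mod a" using w ij by (simp add: cong_def)
      then show "?A i \<inter> ?A j = {}" by (auto simp: cong_def)
    qed
  qed auto
  ultimately show ?thesis using card_residue_class_below[OF a] by simp
qed

text \<open>The remainders \<open>t * d mod a\<close> permute \<open>{..<a}\<close>, so summing the
  division identity for \<open>t * d\<close> over all \<open>t\<close> determines the sum of the
  quotients. The factor 2 avoids halves.\<close>

lemma sum_floor_mult:
  fixes a d :: nat
  assumes "a > 0" "coprime a d"
  shows "2 * (\<Sum>t<a. real (t * d div a)) = (real a - 1) * (real d - 1)"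
proof -
  have s: "2 * (\<Sum>t<a. real t) = real a * (real a - 1)"
    by (induction a) (auto simp: algebra_simps)
  have "(\<Sum>t<a. real (t * d mod a)) = (\<Sum>t<a. real t)"
    using sum.reindex_bij_betw[OF bij_betw_mult_mod[OF assms], of real] by simp
  moreover have "real a * real (t * d div a) + real (t * d mod a) = real d * real t" for t
    by (metis mult.commute mult_div_mod_eq of_nat_add of_nat_mult)
  then have "real a * (\<Sum>t<a. real (t * d div a)) + (\<Sum>t<a. real (t * d mod a))
      = real d * (\<Sum>t<a. real t)"
    by (simp add: sum_distrib_left flip: sum.distrib)
  ultimately have "real a * (2 * (\<Sum>t<a. real (t * d div a))) = (real d - 1) * (2 * (\<Sum>t<a. real t))"
    by (simp add: algebra_simps)
  then have "real a * (2 * (\<Sum>t<a. real (t * d div a))) = real a * ((real a - 1) * (real d - 1))"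
    unfolding s by (simp add: mult.commute mult.left_commute)
  then show ?thesis using assms(1) by simp
qed

section \<open>Sums of members of an interval\<close>

text \<open>\<open>x j\<close> is the multiplicity of \<open>j\<close> in a multiset of
  \<open>s\<close> members of the interval with sum \<open>t\<close>. The bounds suffice because the
  summands can be chosen greedily, one at a time.\<close>

lemma sum_with_multiplicities_iff:
  fixes l m s t :: nat
  assumes "l \<le> m"
  shows "(\<exists>x :: nat \<Rightarrow> nat. (\<Sum>j\<in>{l..m}. x j) = s \<and> (\<Sum>j\<in>{l..m}. x j * j) = t)
    \<longleftrightarrow> s * l \<le> t \<and> t \<le> s * m"
proof
  assume "\<exists>x :: nat \<Rightarrow> nat. (\<Sum>j\<in>{l..m}. x j) = s \<and> (\<Sum>j\<in>{l..m}. x j * j) = t"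
  then obtain x :: "nat \<Rightarrow> nat" where x: "(\<Sum>j\<in>{l..m}. x j) = s" "(\<Sum>j\<in>{l..m}. x j * j) = t"
    by blast
  have "(\<Sum>j\<in>{l..m}. x j * l) \<le> (\<Sum>j\<in>{l..m}. x j * j)"
    "(\<Sum>j\<in>{l..m}. x j * j) \<le> (\<Sum>j\<in>{l..m}. x j * m)"
    by (auto intro!: sum_mono)
  then show "s * l \<le> t \<and> t \<le> s * m" using x by (simp add: sum_distrib_right[symmetric])
next
  assume "s * l \<le> t \<and> t \<le> s * m"
  then show "\<exists>x :: nat \<Rightarrow> nat. (\<Sum>j\<in>{l..m}. x j) = s \<and> (\<Sum>j\<in>{l..m}. x j * j) = t"
  proof (induction s arbitrary: t)
    case 0
    then show ?case by (intro exI[of _ "\<lambda>_. 0"]) simp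
  next
    case (Suc s)
    \<comment> \<open>The largest admissible summand that leaves at least \<open>s * l\<close> for
      the other \<open>s\<close> summands. Either it is \<open>m\<close>, or the rest is exactly
      \<open>s * l\<close>.\<close>
    define u where "u = min m (t - s * l)"
    have u: "l \<le> u" "u \<le> m" "u \<le> t" using Suc.prems assms by (auto simp: u_def)
    have "s * l \<le> t - u \<and> t - u \<le> s * m"
    proof (cases "m \<le> t - s * l")
      case True
      then show ?thesis using Suc.prems assms by (auto simp: u_def)
    next
      case False
      then have "t - u = s * l" using Suc.prems by (auto simp: u_def)
      then show ?thesis using assms by simp
    qed
    then obtain x :: "nat \<Rightarrow> nat" where
      x: "(\<Sum>j\<in>{l..m}. x j) = s" "(\<Sum>j\<in>{l..m}. x j * j) = t - u"
      using Suc.IH by blast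
    have um: "u \<in> {l..m}" using u by simp
    have "(\<Sum>j\<in>{l..m}. x j + of_bool (j = u)) = Suc s"
      using x(1) um by (simp add: sum.distrib)
    moreover have "(\<Sum>j\<in>{l..m}. (x j + of_bool (j = u)) * j) = t"
      using x(2) um u(3) by (simp add: sum.distrib algebra_simps)
    ultimately show ?case by (intro exI[of _ "\<lambda>j. x j + of_bool (j = u)"]) blast
  qed
qed

text \<open>In a representation, \<open>c\<close> counts all generators used, \<open>s\<close> those
  other than the head \<open>a\<close>, and \<open>t\<close> is the sum of the indices
  \<open>j\<close> of the latter. The interval criterion then removes the multiplicities.\<close>

lemma representable_arith_iff:
  fixes a d K k n :: nat
  assumes "K < k"
  shows "representable (a # map (\<lambda>j. a + j * d) [K + 1..<k + 1]) n \<longleftrightarrow>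
    (\<exists>c t s. n = c * a + t * d \<and> s \<le> c \<and> s * (K + 1) \<le> t \<and> t \<le> s * k)"
    (is "?L \<longleftrightarrow> ?R")
proof -
  have idx: "(\<Sum>i<length (a # map (\<lambda>j. a + j * d) [K + 1..<k + 1]).
        x i * (a # map (\<lambda>j. a + j * d) [K + 1..<k + 1]) ! i)
      = x 0 * a + (\<Sum>j\<in>{K + 1..k}. x (j - K) * (a + j * d))" for x :: "nat \<Rightarrow> nat"
  proof -
    have "(\<Sum>i<Suc (k - K). x i * (a # map (\<lambda>j. a + j * d) [K + 1..<k + 1]) ! i)
        = x 0 * a + (\<Sum>i<k - K. x (Suc i) * (a + (K + 1 + i) * d))"
      unfolding sum.lessThan_Suc_shift by (simp del: upt_Suc)
    also have "(\<Sum>i<k - K. x (Suc i) * (a + (K + 1 + i) * d))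
        = (\<Sum>j\<in>{K + 1..k}. x (j - K) * (a + j * d))"
      by (rule sum.reindex_bij_witness[of _ "\<lambda>j. j - (K + 1)" "\<lambda>i. K + 1 + i"])
        (use assms in auto)
    finally show ?thesis using assms by (simp del: upt_Suc)
  qed
  have collect: "x0 * a + (\<Sum>j\<in>{K + 1..k}. x j * (a + j * d))
      = (x0 + (\<Sum>j\<in>{K + 1..k}. x j)) * a + (\<Sum>j\<in>{K + 1..k}. x j * j) * d"
    for x0 and x :: "nat \<Rightarrow> nat"
    by (simp add: algebra_simps sum.distrib sum_distrib_left)
  have Kk: "K + 1 \<le> k" using assms by simp
  show ?thesis
  proof
    assume ?L
    then obtain x :: "nat \<Rightarrow> nat" where
      x: "n = x 0 * a + (\<Sum>j\<in>{K + 1..k}. x (j - K) * (a + j * d))"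
      unfolding representable_def idx by blast
    let ?s = "\<Sum>j\<in>{K + 1..k}. x (j - K)" and ?t = "\<Sum>j\<in>{K + 1..k}. x (j - K) * j"
    have "?s * (K + 1) \<le> ?t \<and> ?t \<le> ?s * k"
      using sum_with_multiplicities_iff[OF Kk, of ?s ?t] by blast
    moreover have "n = (x 0 + ?s) * a + ?t * d"
      using x collect[of "x 0" "\<lambda>j. x (j - K)"] by simp
    ultimately show ?R by (intro exI[of _ "x 0 + ?s"] exI[of _ ?t] exI[of _ ?s]) simp
  next
    assume ?R
    then obtain c t s where h: "n = c * a + t * d" "s \<le> c" "s * (K + 1) \<le> t \<and> t \<le> s * k"
      by blast
    then obtain x :: "nat \<Rightarrow> nat" where
      x: "(\<Sum>j\<in>{K + 1..k}. x j) = s" "(\<Sum>j\<in>{K + 1..k}. x j * j) = t"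
      using sum_with_multiplicities_iff[OF Kk, of s t] by blast
    \<comment> \<open>Position \<open>0\<close> of the list takes the \<open>c - s\<close> copies of
      \<open>a\<close> itself; position \<open>i > 0\<close> holds the generator with index
      \<open>j = i + K\<close>.\<close>
    define y where "y i = (if i = 0 then c - s else x (i + K))" for i
    have "(\<Sum>j\<in>{K + 1..k}. y (j - K) * (a + j * d)) = (\<Sum>j\<in>{K + 1..k}. x j * (a + j * d))"
      by (rule sum.cong) (auto simp: y_def)
    then have "y 0 * a + (\<Sum>j\<in>{K + 1..k}. y (j - K) * (a + j * d)) = n"
      using collect[of "c - s" x] x h(1,2) by (simp add: y_def)
    then show ?L unfolding representable_def idx by metis
  qed
qed

text \<open>\<open>(t + k - 1) div k\<close> is the ceiling of \<open>t / k\<close>, characterized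
  here as the least \<open>c\<close> for which \<open>c\<close> summands of size at most
  \<open>k\<close> can reach \<open>t\<close>.\<close>

lemma ceiling_div_le_iff:
  fixes k t c :: nat
  assumes "k > 0"
  shows "(t + k - 1) div k \<le> c \<longleftrightarrow> t \<le> c * k"
proof -
  have "(t + k - 1) div k < Suc c \<longleftrightarrow> t + k - 1 < Suc c * k"
    using assms by (rule div_less_iff_less_mult)
  then show ?thesis using assms by auto
qed

text \<open>The intervals for \<open>s = 0, 1, 2\<close> are \<open>{0}\<close>,
  \<open>{K + 1..k}\<close> and \<open>{2 * K + 2..2 * k}\<close>, which leaves the two listed gaps.
  No gap follows: the third interval starts at \<open>3 * K + 3 \<le> 2 * k + 1\<close>, and each
  later one starts only \<open>K + 1 \<le> k\<close> after its predecessor.\<close>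

lemma between_multiples_iff:
  fixes K k t :: nat
  assumes "k \<le> 2 * K" "3 * K + 2 \<le> 2 * k"
  shows "(\<exists>s. s * (K + 1) \<le> t \<and> t \<le> s * k) \<longleftrightarrow> t \<notin> {1..K} \<union> {k + 1..2 * K + 1}"
proof
  assume "\<exists>s. s * (K + 1) \<le> t \<and> t \<le> s * k"
  then obtain s where s: "s * (K + 1) \<le> t" "t \<le> s * k" by blast
  consider "s = 0" | "s = 1" | "s \<ge> 2" by linarith
  then show "t \<notin> {1..K} \<union> {k + 1..2 * K + 1}"
  proof cases
    case 3
    then have "2 * (K + 1) \<le> s * (K + 1)" by (rule mult_le_mono1)
    then show ?thesis using s by simp
  qed (use s in auto)
next
  assume t: "t \<notin> {1..K} \<union> {k + 1..2 * K + 1}"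
  define s where "s = (t + k - 1) div k"
  have k: "k > 0" using assms by simp
  have up: "t \<le> s * k" using ceiling_div_le_iff[OF k, of t s] by (simp add: s_def)
  have "s * k \<le> t + k - 1" unfolding s_def by (rule div_times_less_eq_dividend)
  then have lo: "s * k < t + k" using k by simp
  consider "t = 0" | "K + 1 \<le> t" "t \<le> k" | "2 * K + 2 \<le> t" "t \<le> 2 * k" | "2 * k < t"
    using t by fastforce
  then show "\<exists>s. s * (K + 1) \<le> t \<and> t \<le> s * k"
  proof cases
    case 1
    then show ?thesis by (intro exI[of _ 0]) simp
  next
    case 2
    then show ?thesis by (intro exI[of _ 1]) simp
  next
    case 3
    then show ?thesis by (intro exI[of _ 2]) simp
  next
    case 4
    then have "2 * k < s * k" using up by linarith
    then have "3 \<le> s" by simp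
    \<comment> \<open>With this \<open>m\<close>, \<open>s * (K + 1)\<close> is at most
      \<open>2 * k + 1 + m * k = (s - 1) * k + 1\<close>, which is at most \<open>t\<close> by
      \<open>lo\<close>.\<close>
    then obtain m where m: "s = 3 + m" using le_Suc_ex by blast
    have "s * (K + 1) \<le> t"
    proof -
      have "K + 1 \<le> k" using assms by simp
      then have "m * (K + 1) \<le> m * k" by (rule mult_le_mono2)
      then show ?thesis using lo assms by (simp add: m algebra_simps)
    qed
    with up show ?thesis by blast
  qed
qed

section \<open>Sums of ceilings\<close>

text \<open>The term at \<open>0\<close> vanishes; then come \<open>q\<close> blocks of
  \<open>k\<close> equal terms with values \<open>1\<close> to \<open>q\<close>, and
  \<open>r\<close> terms \<open>q + 1\<close>. The boundary \<open>r = k\<close> is allowed so that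
  the induction on \<open>q\<close> can continue from a complete block.\<close>

lemma sum_ceiling_div:
  fixes k q r :: nat
  assumes "k > 0" "r \<le> k"
  shows "2 * (\<Sum>t\<le>q * k + r. (t + k - 1) div k) = k * q * (q + 1) + 2 * r * (q + 1)"
  using assms(2)
proof (induction q arbitrary: r)
  case (0 r)
  then show ?case
  proof (induction r)
    case (Suc r)
    then show ?case using assms(1) by (simp add: div_nat_eqI)
  qed (use assms in simp)
next
  case (Suc q r)
  from Suc.prems show ?case
  proof (induction r)
    case 0
    have "Suc q * k + 0 = q * k + k" by simp
    then show ?case using Suc.IH[of k] by (simp add: algebra_simps)
  next
    case (Suc r)
    have "(Suc q * k + Suc r + k - 1) div k = Suc q + 1"
      by (rule div_nat_eqI) (use Suc.prems assms in \<open>auto simp: algebra_simps\<close>)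
    then show ?case using Suc by (simp add: algebra_simps)
  qed
qed

section \<open>The Sylvester number\<close>

text \<open>For \<open>t < a\<close>, \<open>T t\<close> is the least number congruent to
  \<open>t\<close> modulo \<open>a\<close> outside \<open>B\<close>. An element
  \<open>c * a + u * d\<close> in the class of \<open>t * d\<close> has \<open>u\<close> congruent
  to \<open>t\<close>, hence \<open>T t \<le> u\<close>, and \<open>c\<close> is at least the
  ceiling of \<open>T t / k\<close>. Both minima are attained together, which gives the Apery
  set.\<close>

lemma sylvester_number_arith_eq_sum:
  fixes a d K k :: nat
  defines "B \<equiv> {1..K} \<union> {k + 1..2 * K + 1}"
  defines "T \<equiv> \<lambda>t. if t \<in> B then t + a else t"
  assumes a: "a > 0" and cop: "coprime a d"
    and K1: "k \<le> 2 * K" and K2: "3 * K + 2 \<le> 2 * k" and big: "2 * k \<le> a + K"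
  shows "sylvester_number (a # map (\<lambda>j. a + j * d) [K + 1..<k + 1])
    = (\<Sum>t<a. (T t + k - 1) div k + T t * d div a)"
proof -
  let ?P = "representable (a # map (\<lambda>j. a + j * d) [K + 1..<k + 1])"
  let ?w = "\<lambda>t. a * ((T t + k - 1) div k) + T t * d"
  have k: "k > 0" "K < k" using K1 K2 by auto
  have P: "?P n \<longleftrightarrow> (\<exists>c t. n = c * a + t * d \<and> t \<notin> B \<and> t \<le> c * k)" for n
  proof
    assume "?P n"
    then obtain c t s where h: "n = c * a + t * d" "s \<le> c" "s * (K + 1) \<le> t" "t \<le> s * k"
      unfolding representable_arith_iff[OF k(2)] by blast
    then have "t \<notin> B" using between_multiples_iff[OF K1 K2, of t] unfolding B_def by blast
    moreover have "t \<le> c * k" using h(2,4) by (meson le_trans mult_le_mono1)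
    ultimately show "\<exists>c t. n = c * a + t * d \<and> t \<notin> B \<and> t \<le> c * k" using h(1) by blast
  next
    assume "\<exists>c t. n = c * a + t * d \<and> t \<notin> B \<and> t \<le> c * k"
    then obtain c t where h: "n = c * a + t * d" "t \<notin> B" "t \<le> c * k" by blast
    then obtain s where s: "s * (K + 1) \<le> t" "t \<le> s * k"
      using between_multiples_iff[OF K1 K2, of t] unfolding B_def by blast
    \<comment> \<open>The \<open>s\<close> found may exceed \<open>c\<close>. Cutting it down to
      \<open>min s c\<close> only weakens the lower bound, and the upper bound is then supplied by
      \<open>t \<le> c * k\<close>.\<close>
    have "min s c * (K + 1) \<le> s * (K + 1)" by (rule mult_le_mono1) simp
    then have "min s c * (K + 1) \<le> t" using s by linarith
    moreover have "t \<le> min s c * k" using s h by (simp add: min_def)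
    moreover have "min s c \<le> c" by simp
    ultimately show "?P n" unfolding representable_arith_iff[OF k(2)] using h(1) by blast
  qed
  \<comment> \<open>\<open>big\<close> and \<open>K2\<close> give \<open>2 * K + 2 \<le> a\<close>,
    so adding \<open>a\<close> moves past all of \<open>B\<close>.\<close>
  have T_good: "T t \<notin> B" if "t < a" for t
    using that big K1 K2 by (auto simp: T_def B_def)
  have w: "[?w t = t * d] (mod a)" if "t < a" for t
    by (simp add: T_def cong_def algebra_simps)
  have rep: "?P n \<longleftrightarrow> ?w t \<le> n" if t: "t < a" and n: "[n = t * d] (mod a)" for n t
  proof
    assume "?P n"
    then obtain c u where h: "n = c * a + u * d" "u \<notin> B" "u \<le> c * k" unfolding P by blast
    have "[u * d = t * d] (mod a)" using n h(1) by (simp add: cong_def)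
    then have ut: "[u = t] (mod a)"
      using cop by (simp add: cong_mult_rcancel_nat coprime_commute)
    then have um: "u mod a = t" using t by (simp add: cong_def)
    have "T t \<le> u"
    proof (cases "t \<in> B")
      case True
      then have "u \<noteq> t" using h(2) by blast
      then have "u div a \<noteq> 0" using um by (metis add_0 div_mult_mod_eq mult_0)
      then have "a \<le> a * (u div a)" by simp
      moreover have "u = a * (u div a) + t" using um by (metis mult_div_mod_eq)
      ultimately have "t + a \<le> u" by linarith
      then show ?thesis using True by (simp add: T_def)
    next
      case False
      then show ?thesis using um mod_less_eq_dividend[of u a] by (simp add: T_def)
    qed
    moreover have "(T t + k - 1) div k \<le> c"
      using ceiling_div_le_iff[OF k(1)] \<open>T t \<le> u\<close> h(3) by (meson le_trans)
    then have "a * ((T t + k - 1) div k) \<le> c * a" by simp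
    ultimately show "?w t \<le> n" unfolding h(1) by (intro add_mono) auto
  next
    assume le: "?w t \<le> n"
    have "[n = ?w t] (mod a)" using n w[OF t] by (simp add: cong_def)
    then obtain m where m: "n = ?w t + m * a"
      using le by (metis cong_le_nat cong_sym add.commute mult.commute)
    have "T t \<le> ((T t + k - 1) div k + m) * k"
      using ceiling_div_le_iff[OF k(1), of "T t" "(T t + k - 1) div k + m"] by simp
    moreover have "n = ((T t + k - 1) div k + m) * a + T t * d"
      using m by (simp add: algebra_simps)
    ultimately show "?P n" unfolding P using T_good[OF t] by blast
  qed
  \<comment> \<open>Since \<open>0\<close> is representable, restricting the count to positive
    numbers changes nothing.\<close>
  have "?P 0" unfolding P by (intro exI[of _ 0]) (simp add: B_def)
  then have "{n. n > 0 \<and> \<not> ?P n} = {n. \<not> ?P n}" using gr0I by metis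
  then have "sylvester_number (a # map (\<lambda>j. a + j * d) [K + 1..<k + 1]) = (\<Sum>t<a. ?w t div a)"
    unfolding sylvester_number_def using card_gaps_apery[OF a cop w rep] by simp
  then show ?thesis using a by simp
qed

text \<open>The ceilings are regrouped into initial sums. The shifted \<open>{1..K}\<close>
  continues the range \<open>{..<a}\<close> with only \<open>a\<close> left out, hence the
  correction \<open>C a\<close>; the shifted \<open>{k + 1..2 * K + 1}\<close> is a difference of
  two initial ranges. The replaced terms are \<open>K\<close> ones and \<open>2 * K + 1 - k\<close>
  twos, and each of the \<open>3 * K + 1 - k\<close> shifts adds \<open>d\<close> to a
  floor.\<close>

lemma sylvester_number_arith_ceilings:
  fixes a d K k :: nat
  defines "C \<equiv> \<lambda>t. (t + k - 1) div k"
  assumes a: "a > 0" and cop: "coprime a d"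
    and K1: "k \<le> 2 * K" and K2: "3 * K + 2 \<le> 2 * k" and big: "2 * k \<le> a + K"
  shows "2 * real (sylvester_number (a # map (\<lambda>j. a + j * d) [K + 1..<k + 1])) =
    real (2 * (\<Sum>t\<le>a + K. C t)) + real (2 * (\<Sum>t\<le>a + (2 * K + 1). C t))
      - real (2 * (\<Sum>t\<le>a + k. C t)) - 2 * real (C a)
      - 2 * real K - 4 * (2 * real K + 1 - real k)
      + (real a - 1) * (real d - 1) + 2 * (3 * real K + 1 - real k) * real d"
proof -
  define X Y where "X = {1..K}" and "Y = {k + 1..2 * K + 1}"
  define T where "T t = (if t \<in> X \<union> Y then t + a else t)" for t
  have k: "k > 0" "K < k" using K1 K2 by auto
  have XY: "X \<inter> Y = {}" "X \<union> Y \<subseteq> {..<a}" "finite X" "finite Y"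
    using k K1 K2 big by (auto simp: X_def Y_def)
  have split: "(\<Sum>t\<in>X \<union> Y. f t) = (\<Sum>t\<in>X. f t) + (\<Sum>t\<in>Y. f t)" for f :: "nat \<Rightarrow> real"
    using XY by (simp add: sum.union_disjoint)
  have shift: "(\<Sum>t<a. f (T t)) = (\<Sum>t<a. f t) + (\<Sum>t\<in>X \<union> Y. f (t + a) - f t)"
    for f :: "nat \<Rightarrow> real"
  proof -
    have "(\<Sum>t<a. f (T t)) = (\<Sum>t<a. f t + (if t \<in> X \<union> Y then f (t + a) - f t else 0))"
      by (rule sum.cong) (auto simp: T_def)
    also have "\<dots> = (\<Sum>t<a. f t) + (\<Sum>t\<in>{..<a} \<inter> (X \<union> Y). f (t + a) - f t)"
      by (simp add: sum.distrib sum.inter_restrict)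
    finally show ?thesis using XY(2) by (simp add: Int_absorb1)
  qed
  have "(\<Sum>t\<in>X. real (C t)) = (\<Sum>t\<in>X. 1)"
  proof (rule sum.cong)
    fix t assume "t \<in> X"
    then have "C t = 1" unfolding C_def using k by (intro div_nat_eqI) (auto simp: X_def)
    then show "real (C t) = 1" by simp
  qed simp
  then have CX: "(\<Sum>t\<in>X. real (C t)) = real K" by (simp add: X_def)
  have "(\<Sum>t\<in>Y. real (C t)) = (\<Sum>t\<in>Y. 2)"
  proof (rule sum.cong)
    fix t assume "t \<in> Y"
    then have "C t = 2" unfolding C_def using k K2 by (intro div_nat_eqI) (auto simp: Y_def)
    then show "real (C t) = 2" by simp
  qed simp
  then have CY: "(\<Sum>t\<in>Y. real (C t)) = 2 * (2 * real K + 1 - real k)"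
    using K1 by (simp add: Y_def of_nat_diff)
  have upto: "(\<Sum>t\<le>a + n. f t) = (\<Sum>t\<le>a + m. f t) + (\<Sum>t\<in>{m + 1..n}. f (t + a))"
    if "m \<le> n" for m n and f :: "nat \<Rightarrow> real"
    using that
  proof (induction rule: dec_induct)
    case (step n)
    then show ?case by (simp add: add.commute)
  qed simp
  have CaX: "(\<Sum>t<a. real (C t)) + (\<Sum>t\<in>X. real (C (t + a)))
      = real (\<Sum>t\<le>a + K. C t) - real (C a)"
    using upto[of 0 K "\<lambda>t. real (C t)"] by (simp add: X_def lessThan_Suc_atMost[symmetric])
  have CaY: "(\<Sum>t\<in>Y. real (C (t + a))) = real (\<Sum>t\<le>a + (2 * K + 1). C t) - real (\<Sum>t\<le>a + k. C t)"
    using upto[of k "2 * K + 1" "\<lambda>t. real (C t)"] K1 by (simp add: Y_def)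
  have sumC: "(\<Sum>t<a. real (C (T t))) = real (\<Sum>t\<le>a + K. C t) - real (C a)
      + real (\<Sum>t\<le>a + (2 * K + 1). C t) - real (\<Sum>t\<le>a + k. C t)
      - real K - 2 * (2 * real K + 1 - real k)"
    unfolding shift[of "\<lambda>t. real (C t)"] sum_subtractf split CX CY CaY using CaX by linarith
  have "(t + a) * d div a = d + t * d div a" for t
    using a by (simp add: distrib_right)
  moreover have "real (card (X \<union> Y)) = 3 * real K + 1 - real k"
    using XY K1 by (simp add: card_Un_disjoint X_def Y_def of_nat_diff)
  ultimately have sumD: "2 * (\<Sum>t<a. real (T t * d div a))
      = (real a - 1) * (real d - 1) + 2 * (3 * real K + 1 - real k) * real d"
    unfolding shift[of "\<lambda>t. real (t * d div a)"] distrib_left sum_floor_mult[OF a cop] by simp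
  have "sylvester_number (a # map (\<lambda>j. a + j * d) [K + 1..<k + 1])
      = (\<Sum>t<a. C (T t) + T t * d div a)"
    using sylvester_number_arith_eq_sum[OF a cop K1 K2 big]
    by (simp add: C_def T_def X_def Y_def del: upt_Suc)
  then have "2 * real (sylvester_number (a # map (\<lambda>j. a + j * d) [K + 1..<k + 1]))
      = 2 * (\<Sum>t<a. real (C (T t))) + 2 * (\<Sum>t<a. real (T t * d div a))"
    by (simp add: sum.distrib del: upt_Suc)
  then show ?thesis unfolding sumC sumD by simp
qed

section \<open>Evaluation in the three ranges of the remainder\<close>

theorem theorem6:
  fixes a d K k r N :: nat
  assumes a: "a \<ge> 2" and d: "d > 0" and "coprime a d"
    and K: "K > 0" and k: "k > 0"
    and lower: "(real k - 1) / 2 < real K"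
    and upper: "real K \<le> (2 * real k - 2) / 3"
    and r: "r = a + K - ((a + K) div k) * k"
    and quot: "(a + K) div k \<ge> 2"
    and N: "N = sylvester_number (a # map (\<lambda>j. a + j * d) [K + 1..<k + 1])"
  shows
    "(int r \<le> int k - int K - 1 \<longrightarrow>
        real N = (real a ^ 2 + 2 * (3 * real K - real k) * real a
                   + real K * (5 * real K - 7 * real k) + real k * (2 * real k - 1)
                   - real r * (real r + 4 * real K - 3 * real k)) / (2 * real k)
                 + ((real a + 1) / 2 + 3 * real K - real k) * real d)
     \<and> (int k - int K \<le> int r \<and> r \<le> K \<longrightarrow>
        real N = (real a ^ 2 + 2 * (3 * real K - real k) * real a
                   + (real K - real r) * (5 * real K - 5 * real k + real r) + real k) / (2 * real k)
                 + ((real a + 1) / 2 + 3 * real K - real k) * real d)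
     \<and> (K + 1 \<le> r \<and> r < k \<longrightarrow>
        real N = (real a ^ 2 + 2 * (3 * real K - real k) * real a
                   + real K * (5 * real K - 3 * real k) - real k
                   - real r * (real r + 4 * real K - 3 * real k)) / (2 * real k)
                 + ((real a + 1) / 2 + 3 * real K - real k) * real d)"
proof -
  \<comment> \<open>For integers, the bounds on \<open>K\<close> say that the intervals for one and
    two summands are separated by a gap and that those for two and three are not.\<close>
  have "real k < real (2 * K + 1)" using lower by (simp add: field_simps)
  then have K1: "k \<le> 2 * K" by linarith
  have "real (3 * K + 2) \<le> real (2 * k)" using upper by (simp add: field_simps)
  then have K2: "3 * K + 2 \<le> 2 * k" by linarith
  define q where "q = (a + K) div k"
  have aq: "a + K = q * k + r"
    using r div_times_less_eq_dividend[of "a + K" k] unfolding q_def by linarith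
  have rk: "r < k"
    using aq k mod_less_divisor[of k "a + K"] div_mult_mod_eq[of "a + K" k] unfolding q_def
    by linarith
  have "2 * k \<le> q * k" using quot unfolding q_def by (rule mult_le_mono1)
  then have big: "2 * k \<le> a + K" using aq by linarith
  have ar: "real a = real q * real k + real r - real K"
    using aq by (metis add_diff_cancel_right' of_nat_add of_nat_mult)
  let ?C = "\<lambda>t. (t + k - 1) div k"
  have F: "real (2 * (\<Sum>t\<le>n. ?C t)) = real k * real p * (real p + 1) + 2 * real u * (real p + 1)"
    if "n = p * k + u" "u \<le> k" for n p u
    unfolding that(1) sum_ceiling_div[OF k that(2)] by (simp add: algebra_simps)
  have N2: "2 * real N = real (2 * (\<Sum>t\<le>a + K. ?C t)) + real (2 * (\<Sum>t\<le>a + (2 * K + 1). ?C t))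
      - real (2 * (\<Sum>t\<le>a + k. ?C t)) - 2 * real (?C a)
      - 2 * real K - 4 * (2 * real K + 1 - real k)
      + (real a - 1) * (real d - 1) + 2 * (3 * real K + 1 - real k) * real d"
    unfolding N by (rule sylvester_number_arith_ceilings) (use a assms(3) K1 K2 big in auto)
  have S1: "real (2 * (\<Sum>t\<le>a + K. ?C t)) = real k * real q * (real q + 1) + 2 * real r * (real q + 1)"
    by (rule F) (use aq rk in auto)
  \<comment> \<open>The upper end of this sum is \<open>r + K + 1\<close> beyond
    \<open>q * k\<close>. In \<open>S2\<close> this offset stays within one block of length
    \<open>k\<close>; in \<open>S2'\<close> it runs into the next.\<close>
  have S2: "real (2 * (\<Sum>t\<le>a + (2 * K + 1). ?C t))
      = real k * real q * (real q + 1) + 2 * (real r + real K + 1) * (real q + 1)"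
    if "r + K + 1 \<le> k"
    using F[of "a + (2 * K + 1)" q "r + K + 1"] that aq by simp
  have S2': "real (2 * (\<Sum>t\<le>a + (2 * K + 1). ?C t))
      = real k * (real q + 1) * (real q + 2) + 2 * (real r + real K + 1 - real k) * (real q + 2)"
    if "k \<le> r + K"
    using F[of "a + (2 * K + 1)" "q + 1" "r + K + 1 - k"] that aq rk K2
    by (simp add: of_nat_diff add_ac)
  \<comment> \<open>Relative to \<open>q * k\<close>, the upper end has offset
    \<open>r + k - K\<close>, which fits into one block exactly when \<open>r \<le> K\<close>. The
    same comparison decides whether the ceiling of \<open>a / k\<close> is \<open>q\<close> or
    \<open>q + 1\<close>.\<close>
  have S3: "real (2 * (\<Sum>t\<le>a + k. ?C t))
      = real k * real q * (real q + 1) + 2 * (real r + real k - real K) * (real q + 1)"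
    if "r \<le> K"
  proof -
    have "a + k = q * k + (r + k - K)" "r + k - K \<le> k" using that aq K2 by linarith+
    from F[OF this] show ?thesis using K2 by (simp add: of_nat_diff)
  qed
  have S3': "real (2 * (\<Sum>t\<le>a + k. ?C t))
      = real k * (real q + 1) * (real q + 2) + 2 * (real r - real K) * (real q + 2)"
    if "K < r"
  proof -
    have "a + k = (q + 1) * k + (r - K)" "r - K \<le> k" using that aq rk by auto
    from F[OF this] show ?thesis using that by (simp add: of_nat_diff add_ac)
  qed
  have C: "?C a = q" if "r \<le> K"
    by (rule div_nat_eqI) (use that aq k K2 in \<open>auto simp: algebra_simps\<close>)
  have C': "?C a = q + 1" if "K < r"
    by (rule div_nat_eqI) (use that aq rk in \<open>auto simp: algebra_simps\<close>)
  \<comment> \<open>With denominators cleared and \<open>a\<close> replaced by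
    \<open>q * k + r - K\<close>, each claim becomes a polynomial identity.\<close>
  have fin: "real N = X / (2 * real k) + Y" if "real k * (2 * real N) = X + 2 * real k * Y" for X Y
    using that k by (simp add: field_simps)
  \<comment> \<open>Only three of the four combinations of block positions occur: because
    \<open>k \<le> 2 * K\<close>, \<open>K < r\<close> forces \<open>k \<le> r + K\<close>.\<close>
  show ?thesis
  proof (intro conjI impI; rule fin)
    assume "int r \<le> int k - int K - 1"
    then have "r + K + 1 \<le> k" "r \<le> K" using K1 by linarith+
    then show "real k * (2 * real N) = real a ^ 2 + 2 * (3 * real K - real k) * real a
                   + real K * (5 * real K - 7 * real k) + real k * (2 * real k - 1)
                   - real r * (real r + 4 * real K - 3 * real k)
                 + 2 * real k * (((real a + 1) / 2 + 3 * real K - real k) * real d)"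
      unfolding N2 S1 S2[OF \<open>r + K + 1 \<le> k\<close>] S3[OF \<open>r \<le> K\<close>] C[OF \<open>r \<le> K\<close>] ar
      by (simp add: algebra_simps power2_eq_square add_divide_distrib diff_divide_distrib)
  next
    assume "int k - int K \<le> int r \<and> r \<le> K"
    then have "k \<le> r + K" "r \<le> K" by linarith+
    then show "real k * (2 * real N) = real a ^ 2 + 2 * (3 * real K - real k) * real a
                   + (real K - real r) * (5 * real K - 5 * real k + real r) + real k
                 + 2 * real k * (((real a + 1) / 2 + 3 * real K - real k) * real d)"
      unfolding N2 S1 S2'[OF \<open>k \<le> r + K\<close>] S3[OF \<open>r \<le> K\<close>] C[OF \<open>r \<le> K\<close>] ar
      by (simp add: algebra_simps power2_eq_square add_divide_distrib diff_divide_distrib)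
  next
    assume "K + 1 \<le> r \<and> r < k"
    then have "K < r" "k \<le> r + K" using K1 by linarith+
    then show "real k * (2 * real N) = real a ^ 2 + 2 * (3 * real K - real k) * real a
                   + real K * (5 * real K - 3 * real k) - real k
                   - real r * (real r + 4 * real K - 3 * real k)
                 + 2 * real k * (((real a + 1) / 2 + 3 * real K - real k) * real d)"
      unfolding N2 S1 S2'[OF \<open>k \<le> r + K\<close>] S3'[OF \<open>K < r\<close>] C'[OF \<open>K < r\<close>] ar
      by (simp add: algebra_simps power2_eq_square add_divide_distrib diff_divide_distrib)
  qed
qed

end
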